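(* Let $\alpha>0$ be a constant and let $p=p(n)$ satisfy $p=\Omega(n^{-\alpha})$. Then asymptotically almost surely (i.e. with probability tending to $1$ as $n\to\infty$) the Erdős–Rényi random graph $G(n,p)$ satisfies $$w(G(n,p)) \ge \lceil 1/\alpha + 1 \rceil .$$
   Context: $G(n,p)$ is the random graph on $n$ labeled vertices in which each of the $\binom n2$ possible edges is present independently with probability $p$. All graphs are simple. A graph homomorphism $\phi:G\to H$ is a map $V(G)\to V(H)$ sending edges to edges; $\mathrm{Hom}(G,H)$ denotes the set of homomorphisms. For $d\ge 0$, $T^d$ is the infinite rooted tree in which the root has $d$ children and every other vertex also has exactly $d$ children. A map $\varphi\in\mathrm{Hom}(T^d,G)$ is called cold if there is a vertex $a$ of $G$ such that for every $k$ there is no $\psi\in\mathrm{Hom}(T^d,G)$ that agrees with $\varphi$ on all vertices at distance $k$ from the root $r$ and has $\psi(r)=a$. A graph $G$ is $d$-warm if $\mathrm{Hom}(T^{d-2},G)$ contains no cold maps, and the warmth $w(G)$ is the largest $d$ for which $G$ is $d$-warm. *)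

theory Defs
  imports "HOL-Probability.Probability" "HOL-Library.Landau_Symbols" "HOL-Library.Extended_Nat"
begin

record 'a ugraph =
  verts :: "'a set"
  edges :: "'a set set"

definition simple_graph :: "'a ugraph \<Rightarrow> bool" where
  "simple_graph G \<longleftrightarrow> (\<forall>e\<in>edges G. e \<subseteq> verts G \<and> card e = 2)"

text \<open>Maps are extensional (\<open>undefined\<close> outside the vertex set), so that elements of
  \<open>Hom G H\<close> correspond exactly to maps between the vertex sets.\<close>

definition Hom :: "'a ugraph \<Rightarrow> 'b ugraph \<Rightarrow> ('a \<Rightarrow> 'b) set" where
  "Hom G H = {\<phi> \<in> verts G \<rightarrow>\<^sub>E verts H. \<forall>e\<in>edges G. \<phi> ` e \<in> edges H}"

text \<open>Length of a shortest walk. Vertices in different components would get an unspecified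
  value, but the notion is only used in the connected graphs \<open>tree d\<close>.\<close>

definition graph_dist :: "'a ugraph \<Rightarrow> 'a \<Rightarrow> 'a \<Rightarrow> nat" where
  "graph_dist G u v = (LEAST k. (u, v) \<in> {(x, y). {x, y} \<in> edges G} ^^ k)"

text \<open>The tree \<open>T\<^sup>d\<close>: a vertex is the list of child indices (each below \<open>d\<close>) describing the
  path from that vertex up to the root \<open>[]\<close>, so the children of \<open>xs\<close> are the \<open>i # xs\<close> with \<open>i < d\<close>.
  In particular \<open>T\<^sup>0\<close> is a single vertex.\<close>

definition tree :: "nat \<Rightarrow> nat list ugraph" where
  "tree d = \<lparr>verts = lists {..<d},
             edges = {{xs, i # xs} |xs i. xs \<in> lists {..<d} \<and> i < d}\<rparr>"

lemma simple_graph_tree: "simple_graph (tree d)"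
  by (auto simp: simple_graph_def tree_def card_insert_if)

lemma graph_dist_tree:
  assumes "xs \<in> verts (tree d)"
  shows "graph_dist (tree d) [] xs = length xs"
proof -
  let ?R = "{(x, y). {x, y} \<in> edges (tree d)}"
  have walk: "([], ys) \<in> ?R ^^ length ys" if "ys \<in> lists {..<d}" for ys
    using that
  proof (induction ys)
    case (Cons i ys)
    moreover from Cons have "(ys, i # ys) \<in> ?R"
      by (auto simp: tree_def)
    ultimately show ?case by auto
  qed auto
  have step: "length y \<le> Suc (length x)" if "(x, y) \<in> ?R" for x y
    using that by (auto simp: tree_def doubleton_eq_iff)
  have short: "length ys \<le> k" if "([], ys) \<in> ?R ^^ k" for ys k
    using that
  proof (induction k arbitrary: ys)
    case (Suc k)
    then obtain zs where "([], zs) \<in> ?R ^^ k" "(zs, ys) \<in> ?R" by auto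
    with Suc.IH[of zs] step[of zs ys] show ?case by linarith
  qed auto
  show ?thesis unfolding graph_dist_def
    using assms by (intro Least_equality walk short) (auto simp: tree_def)
qed

definition cold :: "nat \<Rightarrow> 'a ugraph \<Rightarrow> (nat list \<Rightarrow> 'a) \<Rightarrow> bool" where
  "cold d G \<phi> \<longleftrightarrow> \<phi> \<in> Hom (tree d) G \<and>
     (\<exists>a\<in>verts G. \<forall>k. \<not> (\<exists>\<psi>\<in>Hom (tree d) G.
        (\<forall>x\<in>verts (tree d). graph_dist (tree d) [] x = k \<longrightarrow> \<psi> x = \<phi> x) \<and> \<psi> [] = a))"

definition is_warm :: "nat \<Rightarrow> 'a ugraph \<Rightarrow> bool" where
  "is_warm d G \<longleftrightarrow> 2 \<le> d \<and> \<not> (\<exists>\<phi>\<in>Hom (tree (d - 2)) G. cold (d - 2) G \<phi>)"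

text \<open>The supremum in \<open>enat\<close> is the largest \<open>d\<close> if there is one. The set is never empty since
  every graph is \<open>2\<close>-warm; it can be unbounded (e.g. for an edgeless graph, where
  \<open>Hom (tree d) G\<close> is empty for \<open>d \<ge> 1\<close>), and then the warmth is \<open>\<infinity>\<close>.\<close>

definition warmth :: "'a ugraph \<Rightarrow> enat" where
  "warmth G = (SUP d\<in>{d. is_warm d G}. enat d)"

definition vertex_pairs :: "nat \<Rightarrow> nat set set" where
  "vertex_pairs n = {e. e \<subseteq> {1..n} \<and> card e = 2}"

definition gnp :: "nat \<Rightarrow> real \<Rightarrow> nat ugraph pmf" where
  "gnp n p = map_pmf (\<lambda>f. \<lparr>verts = {1..n}, edges = {e \<in> vertex_pairs n. f e}\<rparr>)
               (Pi_pmf (vertex_pairs n) False (\<lambda>_. bernoulli_pmf p))"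

end

theory Submission
  imports Defs "HOL-Real_Asymp.Real_Asymp"
begin

text \<open>Put \<open>m = \<lceil>1/\<alpha>\<rceil> - 1\<close>, so that \<open>n p\<^sup>m\<close> grows like a positive power of \<open>n\<close>. Let \<open>\<phi>\<close> be a
  homomorphism from \<open>T\<^sup>m\<close>. Fix \<open>\<phi>\<close> on level \<open>k\<close> and work upwards: a vertex of the graph is a possible
  new value at a tree vertex iff it has a neighbour among the possible values at each of the
  \<open>m\<close> children. If for all \<open>s < n\<close> any \<open>m\<close> sets of \<open>s\<close> vertices have more than \<open>s\<close> vertices
  adjacent to each of them, then the number of possible values strictly increases from level to
  level, and every vertex is possible at the root when \<open>k = n\<close>. In the random graph a first-moment
  bound shows that this expansion fails for a given \<open>s\<close> with probability at most \<open>1/n\<^sup>2\<close>.\<close>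

subsection \<open>Warmth from expansion\<close>

definition common_nbrs :: "'a ugraph \<Rightarrow> 'b set \<Rightarrow> ('b \<Rightarrow> 'a set) \<Rightarrow> 'a set" where
  "common_nbrs G I S = {v \<in> verts G. \<forall>i\<in>I. \<exists>u\<in>S i. {u, v} \<in> edges G}"

text \<open>The sets \<open>S i\<close> may overlap or coincide. Size exactly \<open>s\<close> is
  enough, since \<open>common_nbrs\<close> is monotone in \<open>S\<close> and larger sets can be
  shrunk first.\<close>

definition expands :: "'a ugraph \<Rightarrow> nat \<Rightarrow> nat \<Rightarrow> bool" where
  "expands G m s \<longleftrightarrow> (\<forall>S. (\<forall>i<m. S i \<subseteq> verts G \<and> card (S i) = s) \<longrightarrow>
     s < card (common_nbrs G {..<m} S))"

lemma common_nbrs_subset: "common_nbrs G I S \<subseteq> verts G"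
  by (auto simp: common_nbrs_def)

lemma common_nbrs_mono: "(\<And>i. i \<in> I \<Longrightarrow> S i \<subseteq> S' i) \<Longrightarrow> common_nbrs G I S \<subseteq> common_nbrs G I S'"
  unfolding common_nbrs_def by blast

lemma graph_dist_tree_root:
  assumes "x \<in> lists {..<m}"
  shows "graph_dist (tree m) [] x = length x"
  using assms by (intro graph_dist_tree) (simp add: tree_def)

text \<open>The values at \<open>x\<close> of the homomorphisms from the first \<open>j\<close> levels below \<open>x\<close> that agree
  with \<open>\<phi>\<close> on the last of these levels.\<close>

primrec reach :: "'a ugraph \<Rightarrow> nat \<Rightarrow> (nat list \<Rightarrow> 'a) \<Rightarrow> nat \<Rightarrow> nat list \<Rightarrow> 'a set" where
  "reach G m \<phi> 0 x = {\<phi> x}"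
| "reach G m \<phi> (Suc j) x = common_nbrs G {..<m} (\<lambda>i. reach G m \<phi> j (i # x))"

lemma reach_subset:
  assumes "\<phi> \<in> Hom (tree m) G" "x \<in> lists {..<m}"
  shows "reach G m \<phi> j x \<subseteq> verts G"
proof (cases j)
  case 0
  then show ?thesis using assms by (auto simp: Hom_def tree_def)
qed (simp add: common_nbrs_subset)

lemma Hom_tree_edge:
  assumes "\<phi> \<in> Hom (tree m) G" "x \<in> lists {..<m}" "i < m"
  shows "{\<phi> (i # x), \<phi> x} \<in> edges G"
proof -
  have "{x, i # x} \<in> edges (tree m)"
    using assms by (auto simp: tree_def)
  hence "\<phi> ` {x, i # x} \<in> edges G"
    using assms(1) unfolding Hom_def by blast
  thus ?thesis by (simp add: insert_commute)
qed

text \<open>The map is built from the root downwards: each child gets a neighbour of its parent's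
  value, chosen in the child's own \<open>reach\<close> set. At level \<open>k\<close> these sets
  are the singletons of \<phi>, so from there on the map can follow \<phi>.\<close>

lemma reach_root_extends:
  assumes \<phi>: "\<phi> \<in> Hom (tree m) G" and a: "a \<in> reach G m \<phi> k []"
  shows "\<exists>\<psi>\<in>Hom (tree m) G.
    (\<forall>x\<in>verts (tree m). graph_dist (tree m) [] x = k \<longrightarrow> \<psi> x = \<phi> x) \<and> \<psi> [] = a"
proof -
  \<comment> \<open>The tail of a list is its parent, so \<open>r\<close> is the value already
    chosen at the parent \<open>x\<close> of \<open>i # x\<close>.\<close>
  define \<psi> where "\<psi> = rec_list a (\<lambda>i x r. if length x < k
    then SOME u. u \<in> reach G m \<phi> (k - Suc (length x)) (i # x) \<and> {u, r} \<in> edges G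
    else \<phi> (i # x))"
  have \<psi>_Nil: "\<psi> [] = a"
    by (simp add: \<psi>_def)
  have step: "\<psi> (i # x) \<in> reach G m \<phi> (k - Suc (length x)) (i # x) \<and> {\<psi> (i # x), \<psi> x} \<in> edges G"
    if "length x < k" "\<psi> x \<in> reach G m \<phi> (k - length x) x" "i < m" for i x
  proof -
    obtain j where j: "k - length x = Suc j"
      using \<open>length x < k\<close> by (metis Suc_diff_Suc)
    hence "k - Suc (length x) = j" by simp
    with that j have "\<exists>u. u \<in> reach G m \<phi> (k - Suc (length x)) (i # x) \<and> {u, \<psi> x} \<in> edges G"
      by (auto simp: common_nbrs_def)
    from someI_ex[OF this] show ?thesis
      using that by (simp add: \<psi>_def)
  qed
  have reach: "\<psi> x \<in> reach G m \<phi> (k - length x) x" if "x \<in> lists {..<m}" "length x \<le> k" for x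
    using that
  proof (induction x)
    case Nil
    then show ?case using a \<psi>_Nil by simp
  next
    case (Cons i x)
    then show ?case using step[of x i] by auto
  qed
  have deep: "\<psi> x = \<phi> x" if "x \<in> lists {..<m}" "k \<le> length x" for x
  proof (cases "length x = k")
    case True
    then show ?thesis using reach[OF that(1)] by simp
  next
    case False
    then show ?thesis using that by (cases x) (auto simp: \<psi>_def)
  qed
  have edge: "{\<psi> (i # x), \<psi> x} \<in> edges G" if "x \<in> lists {..<m}" "i < m" for i x
  proof (cases "length x < k")
    case True
    then show ?thesis using step reach that by simp
  next
    case False
    then show ?thesis using Hom_tree_edge[OF \<phi> that] deep that by simp
  qed
  have vert: "\<psi> x \<in> verts G" if "x \<in> lists {..<m}" for x
  proof (cases "length x \<le> k")
    case True
    then show ?thesis using reach reach_subset[OF \<phi>] that by blast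
  next
    case False
    then show ?thesis using deep reach_subset[OF \<phi>, of x 0] that by simp
  qed
  \<comment> \<open>Members of \<open>Hom\<close> are \<open>undefined\<close> off the tree, whereas
    the recursion assigns values to all lists.\<close>
  have "restrict \<psi> (lists {..<m}) ` e \<in> edges G" if "e \<in> edges (tree m)" for e
  proof -
    obtain x i where "e = {x, i # x}" "x \<in> lists {..<m}" "i < m"
      using \<open>e \<in> edges (tree m)\<close> by (auto simp: tree_def)
    thus ?thesis using edge[of x i] by (simp add: insert_commute)
  qed
  hence "restrict \<psi> (lists {..<m}) \<in> Hom (tree m) G"
    using vert by (simp add: Hom_def tree_def)
  moreover have "\<forall>x\<in>verts (tree m). graph_dist (tree m) [] x = k \<longrightarrow>
      restrict \<psi> (lists {..<m}) x = \<phi> x"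
  proof (intro ballI impI)
    fix x assume "x \<in> verts (tree m)" "graph_dist (tree m) [] x = k"
    moreover from this have "x \<in> lists {..<m}" by (simp add: tree_def)
    ultimately show "restrict \<psi> (lists {..<m}) x = \<phi> x"
      using deep by (auto simp: graph_dist_tree_root)
  qed
  moreover have "restrict \<psi> (lists {..<m}) [] = a"
    using \<psi>_Nil by simp
  ultimately show ?thesis by blast
qed

lemma card_reach_ge:
  assumes fin: "finite (verts G)" and two: "2 \<le> card (verts G)"
    and exp: "\<And>s. 1 \<le> s \<Longrightarrow> s < card (verts G) \<Longrightarrow> expands G m s"
    and \<phi>: "\<phi> \<in> Hom (tree m) G" and x: "x \<in> lists {..<m}"
  shows "min (Suc j) (card (verts G)) \<le> card (reach G m \<phi> j x)"
  using x
proof (induction j arbitrary: x)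
  case (Suc j)
  \<comment> \<open>Expansion is assumed only below \<open>card (verts G)\<close>. With the cap one
    below it, \<open>s + 1\<close> is exactly the minimum required for \<open>Suc j\<close>.\<close>
  define s where "s = min (Suc j) (card (verts G) - 1)"
  have s: "1 \<le> s" "s < card (verts G)"
    using two by (auto simp: s_def)
  have "\<exists>T\<subseteq>reach G m \<phi> j (i # x). card T = s" if "i < m" for i
  proof (rule obtain_subset_with_card_n)
    have "s \<le> min (Suc j) (card (verts G))" by (simp add: s_def)
    also have "\<dots> \<le> card (reach G m \<phi> j (i # x))"
      using that Suc by simp
    finally show "s \<le> card (reach G m \<phi> j (i # x))" .
  qed blast
  then obtain S where S: "\<And>i. i < m \<Longrightarrow> S i \<subseteq> reach G m \<phi> j (i # x) \<and> card (S i) = s"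
    by metis
  hence "S i \<subseteq> verts G \<and> card (S i) = s" if "i < m" for i
    using that reach_subset[OF \<phi>, of "i # x" j] Suc.prems by (fastforce simp: subset_iff)
  hence "s < card (common_nbrs G {..<m} S)"
    using exp[OF s] unfolding expands_def by blast
  also have "\<dots> \<le> card (reach G m \<phi> (Suc j) x)"
    using S fin by (auto intro!: card_mono common_nbrs_mono finite_subset[OF common_nbrs_subset])
  finally show ?case
    by (auto simp: s_def)
qed (use two in simp)

text \<open>After \<open>card (verts G)\<close> levels the reach set of the root is everything, so a
  single \<open>k\<close> refutes coldness for every value \<open>a\<close>.\<close>

lemma is_warm_if_expands:
  assumes "finite (verts G)" "2 \<le> card (verts G)"
    and "\<And>s. 1 \<le> s \<Longrightarrow> s < card (verts G) \<Longrightarrow> expands G m s"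
  shows "is_warm (m + 2) G"
proof -
  have "\<not> cold m G \<phi>" if \<phi>: "\<phi> \<in> Hom (tree m) G" for \<phi>
  proof -
    have "reach G m \<phi> (card (verts G)) [] = verts G"
      using card_reach_ge[OF assms \<phi>, of "[]" "card (verts G)"] reach_subset[OF \<phi>] assms(1)
      by (intro card_seteq) auto
    thus ?thesis
      using reach_root_extends[OF \<phi>, of _ "card (verts G)"] unfolding cold_def by blast
  qed
  thus ?thesis by (simp add: is_warm_def)
qed

text \<open>\<open>tree 0\<close> has no vertex at distance 1, so with \<open>k = 1\<close> nothing
  constrains the root. This serves the case \<alpha> \<ge> 1.\<close>

lemma is_warm_2: "is_warm 2 G"
proof -
  have "\<not> cold 0 G \<phi>" if "\<phi> \<in> Hom (tree 0) G" for \<phi>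
  proof -
    have "\<exists>\<psi>\<in>Hom (tree 0) G.
      (\<forall>x\<in>verts (tree 0). graph_dist (tree 0) [] x = 1 \<longrightarrow> \<psi> x = \<phi> x) \<and> \<psi> [] = a"
      if "a \<in> verts G" for a
      using that by (intro reach_root_extends[OF \<open>\<phi> \<in> _\<close>]) (simp add: common_nbrs_def)
    thus ?thesis unfolding cold_def by blast
  qed
  thus ?thesis by (simp add: is_warm_def)
qed

lemma warmth_ge: "is_warm d G \<Longrightarrow> enat d \<le> warmth G"
  unfolding warmth_def by (intro SUP_upper) simp

subsection \<open>Independence in products of Bernoulli distributions\<close>

lemma prob_pair_pmf_Times:
  "measure_pmf.prob (pair_pmf M N) (A \<times> B) = measure_pmf.prob M A * measure_pmf.prob N B"
proof -
  \<comment> \<open>Intersecting with the supports changes no probability and makes both factors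
    countable, as the product rule demands.\<close>
  have "measure_pmf.prob (pair_pmf M N) (A \<times> B) =
      measure_pmf.prob (pair_pmf M N) ((A \<inter> set_pmf M) \<times> (B \<inter> set_pmf N))"
    by (subst measure_Int_set_pmf[symmetric]) (auto intro!: arg_cong2[where f = measure])
  also have "\<dots> = measure_pmf.prob M (A \<inter> set_pmf M) * measure_pmf.prob N (B \<inter> set_pmf N)"
    by (intro measure_pmf_prob_product countable_Int2) simp_all
  finally show ?thesis
    by (simp add: measure_Int_set_pmf)
qed

text \<open>Stands in for measurability with respect to the sigma-algebra of the coordinates in
  \<open>K\<close>.\<close>

definition depends_on :: "'a set \<Rightarrow> ('a \<Rightarrow> 'b) set \<Rightarrow> bool" where
  "depends_on K X \<longleftrightarrow> (\<forall>f g. (\<forall>x\<in>K. f x = g x) \<longrightarrow> (f \<in> X \<longleftrightarrow> g \<in> X))"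

lemma depends_onD: "depends_on K X \<Longrightarrow> (\<And>x. x \<in> K \<Longrightarrow> f x = g x) \<Longrightarrow> f \<in> X \<longleftrightarrow> g \<in> X"
  unfolding depends_on_def by blast

text \<open>A sample over \<open>A\<close> is glued from independent samples over \<open>K\<close>
  and \<open>A - K\<close>; \<open>X\<close> sees only the first, \<open>Y\<close> only the
  second.\<close>

lemma prob_Pi_pmf_indep:
  assumes A: "finite A" "K \<subseteq> A" and X: "depends_on K X" and Y: "depends_on (- K) Y"
  shows "measure_pmf.prob (Pi_pmf A d p) (X \<inter> Y) =
    measure_pmf.prob (Pi_pmf A d p) X * measure_pmf.prob (Pi_pmf A d p) Y"
proof -
  let ?h = "\<lambda>(f, g) x. if x \<in> K then f x else g x"
  let ?M = "pair_pmf (Pi_pmf K d p) (Pi_pmf (A - K) d p)"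
  have "Pi_pmf (K \<union> (A - K)) d p = map_pmf ?h ?M"
    using A by (intro Pi_pmf_union) (auto intro: finite_subset)
  moreover have "K \<union> (A - K) = A" using A by blast
  ultimately have M: "Pi_pmf A d p = map_pmf ?h ?M" by simp
  have hX: "?h (f, g) \<in> X \<longleftrightarrow> f \<in> X" for f g
    by (rule depends_onD[OF X]) simp
  have hY: "?h (f, g) \<in> Y \<longleftrightarrow> g \<in> Y" for f g
    by (rule depends_onD[OF Y]) simp
  have "?h -` (X \<inter> Y) = X \<times> Y" "?h -` X = X \<times> UNIV" "?h -` Y = UNIV \<times> Y"
    using hX hY by auto
  thus ?thesis
    by (simp add: M prob_pair_pmf_Times)
qed

lemma prob_Pi_pmf_INT_indep:
  fixes X :: "'v \<Rightarrow> ('a \<Rightarrow> 'b) set"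
  assumes A: "finite A" and "finite T"
    and "\<And>v. v \<in> T \<Longrightarrow> K v \<subseteq> A" "disjoint_family_on K T"
    and "\<And>v. v \<in> T \<Longrightarrow> depends_on (K v) (X v)"
  shows "measure_pmf.prob (Pi_pmf A d p) (\<Inter>v\<in>T. X v) =
    (\<Prod>v\<in>T. measure_pmf.prob (Pi_pmf A d p) (X v))"
  using assms(2-)
proof (induction T rule: finite_induct)
  case (insert v T)
  have "depends_on (- K v) (\<Inter>w\<in>T. X w)"
    unfolding depends_on_def
  proof (intro allI impI)
    fix f g :: "'a \<Rightarrow> 'b" assume fg: "\<forall>x\<in>- K v. f x = g x"
    have "f \<in> X w \<longleftrightarrow> g \<in> X w" if "w \<in> T" for w
    proof (rule depends_onD)
      show "depends_on (K w) (X w)" using that insert by blast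
      have "K w \<inter> K v = {}"
        using insert.prems(2) that insert.hyps(2) by (auto simp: disjoint_family_on_def)
      thus "f x = g x" if "x \<in> K w" for x using that fg by blast
    qed
    thus "f \<in> (\<Inter>w\<in>T. X w) \<longleftrightarrow> g \<in> (\<Inter>w\<in>T. X w)" by blast
  qed
  moreover have "disjoint_family_on K T"
    using insert.prems(2) by (rule disjoint_family_on_mono[rotated]) blast
  ultimately show ?case
    using insert prob_Pi_pmf_indep[OF A, of "K v" "X v" "\<Inter>w\<in>T. X w" d p] by simp
qed simp

lemma prob_bernoulli_all_False:
  assumes "finite A" "S \<subseteq> A" "0 \<le> p" "p \<le> 1"
  shows "measure_pmf.prob (Pi_pmf A False (\<lambda>_. bernoulli_pmf p)) {f. \<forall>e\<in>S. \<not> f e} =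
    (1 - p) ^ card S"
proof -
  let ?B = "\<lambda>e. if e \<in> S then {False} else UNIV"
  have "{f. \<forall>e\<in>S. \<not> f e} = Pi A ?B"
    using assms(2) by (auto simp: Pi_iff split: if_splits)
  hence "measure_pmf.prob (Pi_pmf A False (\<lambda>_. bernoulli_pmf p)) {f. \<forall>e\<in>S. \<not> f e} =
      (\<Prod>e\<in>A. measure_pmf.prob (bernoulli_pmf p) (?B e))"
    using assms(1) by (simp only: measure_Pi_pmf_Pi)
  also have "\<dots> = (\<Prod>e\<in>S. 1 - p)"
    using assms by (intro prod.mono_neutral_cong_right) (auto simp: measure_pmf_single)
  finally show ?thesis by simp
qed

text \<open>The events are positively correlated: given that \<open>S m\<close> is not hit, the other sets lose the
  part that they share with \<open>S m\<close>, which only makes them harder to hit.\<close>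

lemma prob_bernoulli_hit_all_ge:
  assumes A: "finite A" and p: "0 \<le> p" "p \<le> 1"
    and "\<And>i. i < m \<Longrightarrow> S i \<subseteq> A \<and> card (S i) = s"
  shows "(1 - (1 - p) ^ s) ^ m \<le>
    measure_pmf.prob (Pi_pmf A False (\<lambda>_. bernoulli_pmf p)) {f. \<forall>i<m. \<exists>e\<in>S i. f e}"
  using assms(4)
proof (induction m)
  case (Suc m)
  let ?P = "measure_pmf.prob (Pi_pmf A False (\<lambda>_. bernoulli_pmf p))"
  define E where "E = {f. \<forall>i<m. \<exists>e\<in>S i. f e}"
  define E' where "E' = {f. \<forall>i<m. \<exists>e\<in>S i - S m. f e}"
  define N where "N = {f. \<forall>e\<in>S m. \<not> f e}"
  have Sm: "S m \<subseteq> A" "card (S m) = s" using Suc.prems by auto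
  have N: "?P N = (1 - p) ^ s"
    unfolding N_def using prob_bernoulli_all_False[OF A Sm(1) p] Sm by simp
  have "{f. \<forall>i<Suc m. \<exists>e\<in>S i. f e} = E - N"
    by (auto simp: E_def N_def less_Suc_eq)
  moreover have "?P (E - N) = ?P E - ?P (N \<inter> E)"
    by (subst measure_pmf.finite_measure_Diff'[of E _ N]) (simp_all add: Int_commute)
  \<comment> \<open>Once \<open>S m\<close> is missed, the other sets can be hit only outside it.
    Unlike \<open>E\<close>, the event \<open>E'\<close> ignores \<open>S m\<close> and so is
    independent of \<open>N\<close>.\<close>
  moreover have "N \<inter> E = N \<inter> E'"
    unfolding N_def E_def E'_def by blast
  moreover have "depends_on (S m) N" "depends_on (- S m) E'"
    unfolding depends_on_def N_def E'_def by auto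
  hence "?P (N \<inter> E') = ?P N * ?P E'"
    using A Sm by (intro prob_Pi_pmf_indep)
  moreover have "?P E' \<le> ?P E"
    unfolding E_def E'_def by (intro measure_pmf.finite_measure_mono) auto
  hence "?P N * ?P E' \<le> (1 - p) ^ s * ?P E"
    unfolding N using p by (intro mult_left_mono) auto
  moreover have "(1 - (1 - p) ^ s) ^ m * (1 - (1 - p) ^ s) \<le> ?P E * (1 - (1 - p) ^ s)"
    using p Suc by (intro mult_right_mono) (auto simp: E_def power_le_one)
  ultimately show ?case by (simp add: algebra_simps)
qed simp

subsection \<open>Expansion in the random graph\<close>

definition edge_pmf :: "nat \<Rightarrow> real \<Rightarrow> (nat set \<Rightarrow> bool) pmf" where
  "edge_pmf n p = Pi_pmf (vertex_pairs n) False (\<lambda>_. bernoulli_pmf p)"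

definition graph_of :: "nat \<Rightarrow> (nat set \<Rightarrow> bool) \<Rightarrow> nat ugraph" where
  "graph_of n f = \<lparr>verts = {1..n}, edges = {e \<in> vertex_pairs n. f e}\<rparr>"

lemma gnp_eq: "gnp n p = map_pmf (graph_of n) (edge_pmf n p)"
  unfolding gnp_def edge_pmf_def graph_of_def by (rule refl)

lemma verts_graph_of [simp]: "verts (graph_of n f) = {1..n}"
  by (simp add: graph_of_def)

lemma edges_graph_of [simp]: "edges (graph_of n f) = {e \<in> vertex_pairs n. f e}"
  by (simp add: graph_of_def)

lemma finite_vertex_pairs [simp]: "finite (vertex_pairs n)"
  by (rule finite_subset[of _ "Pow {1..n}"]) (auto simp: vertex_pairs_def)

lemma doubleton_in_vertex_pairs:
  "{u, v} \<in> vertex_pairs n \<longleftrightarrow> u \<in> {1..n} \<and> v \<in> {1..n} \<and> u \<noteq> v"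
  by (auto simp: vertex_pairs_def card_insert_if)

definition subsets_of_card :: "nat \<Rightarrow> nat \<Rightarrow> nat set set" where
  "subsets_of_card n s = {B. B \<subseteq> {1..n} \<and> card B = s}"

lemma finite_subsets_of_card [simp]: "finite (subsets_of_card n s)"
  by (rule finite_subset[of _ "Pow {1..n}"]) (auto simp: subsets_of_card_def)

lemma card_subsets_of_card: "card (subsets_of_card n s) = n choose s"
  using n_subsets[of "{1..n}" s] by (simp add: subsets_of_card_def)

lemma card_subsets_of_card_le: "s \<le> n \<Longrightarrow> card (subsets_of_card n s) \<le> n ^ s"
  by (simp add: card_subsets_of_card binomial_le_pow)

section \<open>Small \<open>s\<close>: union bound over whole families of sets\<close>

lemma prob_UN_le:
  assumes "finite I" "\<And>i. i \<in> I \<Longrightarrow> measure_pmf.prob M (X i) \<le> c"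
  shows "measure_pmf.prob M (\<Union>i\<in>I. X i) \<le> real (card I) * c"
proof -
  have "measure_pmf.prob M (\<Union>i\<in>I. X i) \<le> (\<Sum>i\<in>I. measure_pmf.prob M (X i))"
    using assms(1) by (intro measure_pmf.finite_measure_subadditive_finite) auto
  also have "\<dots> \<le> (\<Sum>i\<in>I. c)"
    using assms(2) by (rule sum_mono)
  finally show ?thesis by simp
qed

text \<open>Only vertices outside \<open>B\<close> and all \<open>S i\<close> are tested. Their
  edges to the union of the \<open>S i\<close> form disjoint sets, so the tests are independent, and
  every one of them has to fail. At least \<open>n - (m + 1) * s\<close> such vertices
  exist.\<close>

lemma prob_common_nbrs_subset_le:
  assumes p: "0 \<le> p" "p \<le> 1"
    and S: "\<And>i. i < m \<Longrightarrow> S i \<in> subsets_of_card n s" and B: "B \<in> subsets_of_card n s"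
  shows "measure_pmf.prob (edge_pmf n p) {f. common_nbrs (graph_of n f) {..<m} S \<subseteq> B}
    \<le> (1 - (1 - (1 - p) ^ s) ^ m) ^ (n - (m + 1) * s)"
proof -
  let ?P = "measure_pmf.prob (edge_pmf n p)"
  define U where "U = (\<Union>i<m. S i)"
  define T where "T = {1..n} - B - U"
  define K where "K v = (\<lambda>u. {u, v}) ` U" for v
  define H where "H v = {f. \<forall>i<m. \<exists>e\<in>(\<lambda>u. {u, v}) ` S i. f e}" for v :: nat
  have B': "finite B" "card B = s" "B \<subseteq> {1..n}"
    using B by (auto simp: subsets_of_card_def intro: finite_subset)
  have S': "finite (S i)" "card (S i) = s" "S i \<subseteq> {1..n}" if "i < m" for i
    using S[OF that] by (auto simp: subsets_of_card_def intro: finite_subset)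
  have "card U \<le> (\<Sum>i<m. card (S i))"
    unfolding U_def by (rule card_UN_le) simp
  also have "\<dots> = m * s"
    using S' by simp
  finally have "card U \<le> m * s" .
  moreover have "finite U" using S' by (simp add: U_def)
  ultimately have "n - (m + 1) * s \<le> card T"
    using B' diff_card_le_card_Diff[of U "{1..n} - B"] by (simp add: T_def card_Diff_subset)
  have q: "0 \<le> (1 - (1 - p) ^ s) ^ m" "(1 - (1 - p) ^ s) ^ m \<le> 1"
    using p by (auto simp: power_le_one)
  have edge: "{u, v} \<in> vertex_pairs n" if "v \<in> T" "u \<in> U" for u v
    using that S'(3) by (fastforce simp: T_def U_def doubleton_in_vertex_pairs)
  have H: "(1 - (1 - p) ^ s) ^ m \<le> ?P (H v)" if "v \<in> T" for v
    unfolding H_def edge_pmf_def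
  proof (rule prob_bernoulli_hit_all_ge)
    fix i assume "i < m"
    moreover have "inj_on (\<lambda>u. {u, v}) (S i)"
      by (auto simp: inj_on_def doubleton_eq_iff)
    ultimately show "(\<lambda>u. {u, v}) ` S i \<subseteq> vertex_pairs n \<and> card ((\<lambda>u. {u, v}) ` S i) = s"
      using edge[OF that] S'(2) by (auto simp: card_image U_def)
  qed (use p in auto)
  have "{f. common_nbrs (graph_of n f) {..<m} S \<subseteq> B} \<subseteq> (\<Inter>v\<in>T. - H v)"
  proof (intro subsetI INT_I ComplI)
    fix f v assume f: "f \<in> {f. common_nbrs (graph_of n f) {..<m} S \<subseteq> B}" and v: "v \<in> T" "f \<in> H v"
    have "v \<in> common_nbrs (graph_of n f) {..<m} S"
      unfolding common_nbrs_def
    proof (intro CollectI conjI ballI)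
      show "v \<in> verts (graph_of n f)" using v by (simp add: T_def)
      fix i assume "i \<in> {..<m}"
      then obtain u where "u \<in> S i" "f {u, v}" using v by (auto simp: H_def)
      moreover from this \<open>i \<in> {..<m}\<close> have "{u, v} \<in> vertex_pairs n"
        using edge[OF v(1)] by (auto simp: U_def)
      ultimately show "\<exists>u\<in>S i. {u, v} \<in> edges (graph_of n f)" by auto
    qed
    with f v show False by (auto simp: T_def)
  qed
  hence "?P {f. common_nbrs (graph_of n f) {..<m} S \<subseteq> B} \<le> ?P (\<Inter>v\<in>T. - H v)"
    by (rule measure_pmf.finite_measure_mono) simp
  also have "\<dots> = (\<Prod>v\<in>T. ?P (- H v))"
    unfolding edge_pmf_def
  proof (rule prob_Pi_pmf_INT_indep)
    show "K v \<subseteq> vertex_pairs n" if "v \<in> T" for v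
      using edge[OF that] by (auto simp: K_def)
    show "disjoint_family_on K T"
      by (auto simp: disjoint_family_on_def K_def T_def doubleton_eq_iff)
    show "depends_on (K v) (- H v)" for v
      unfolding depends_on_def H_def K_def U_def by fastforce
  qed (auto simp: T_def)
  also have "\<dots> \<le> (\<Prod>v\<in>T. 1 - (1 - (1 - p) ^ s) ^ m)"
    using H by (intro prod_mono)
      (auto simp: measure_pmf.prob_compl[of _ "edge_pmf n p", simplified] Compl_eq_Diff_UNIV)
  also have "\<dots> = (1 - (1 - (1 - p) ^ s) ^ m) ^ card T"
    by simp
  also have "\<dots> \<le> (1 - (1 - (1 - p) ^ s) ^ m) ^ (n - (m + 1) * s)"
    using q \<open>n - (m + 1) * s \<le> card T\<close> by (intro power_decreasing) auto
  finally show ?thesis .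
qed

text \<open>If expansion fails, the common neighbours fit into some \<open>B\<close> of size exactly
  \<open>s\<close>. There are at most \<open>n ^ s\<close> choices for \<open>B\<close> and for each
  of the \<open>m\<close> sets.\<close>

lemma prob_not_expands_le_few:
  assumes p: "0 \<le> p" "p \<le> 1" and s: "s \<le> n"
  shows "measure_pmf.prob (edge_pmf n p) {f. \<not> expands (graph_of n f) m s}
    \<le> real n ^ ((m + 1) * s) * (1 - (1 - (1 - p) ^ s) ^ m) ^ (n - (m + 1) * s)"
proof -
  let ?I = "(\<Pi>\<^sub>E i\<in>{..<m}. subsets_of_card n s) \<times> subsets_of_card n s"
  let ?X = "\<lambda>(S, B). {f. common_nbrs (graph_of n f) {..<m} S \<subseteq> B}"
  let ?b = "(1 - (1 - (1 - p) ^ s) ^ m) ^ (n - (m + 1) * s)"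
  have "{f. \<not> expands (graph_of n f) m s} \<subseteq> (\<Union>x\<in>?I. ?X x)"
  proof
    fix f assume "f \<in> {f. \<not> expands (graph_of n f) m s}"
    then obtain S where S: "\<forall>i<m. S i \<subseteq> {1..n} \<and> card (S i) = s"
        "card (common_nbrs (graph_of n f) {..<m} S) \<le> s"
      by (auto simp: expands_def not_less)
    obtain B where "common_nbrs (graph_of n f) {..<m} S \<subseteq> B" "B \<subseteq> {1..n}" "card B = s"
      using exists_subset_between[OF S(2), of "{1..n}"] s
        common_nbrs_subset[of "graph_of n f" "{..<m}" S] by auto
    \<comment> \<open>Restricting \<open>S\<close> to the indices below \<open>m\<close> leaves
      finitely many families for the union bound.\<close>
    moreover have "common_nbrs (graph_of n f) {..<m} (restrict S {..<m}) =
        common_nbrs (graph_of n f) {..<m} S"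
      by (auto simp: common_nbrs_def)
    ultimately have "(restrict S {..<m}, B) \<in> ?I \<and> f \<in> ?X (restrict S {..<m}, B)"
      using S by (auto simp: subsets_of_card_def)
    thus "f \<in> (\<Union>x\<in>?I. ?X x)" by blast
  qed
  hence "measure_pmf.prob (edge_pmf n p) {f. \<not> expands (graph_of n f) m s} \<le>
      measure_pmf.prob (edge_pmf n p) (\<Union>x\<in>?I. ?X x)"
    by (rule measure_pmf.finite_measure_mono) simp
  also have "\<dots> \<le> real (card ?I) * ?b"
  proof (rule prob_UN_le)
    show "finite ?I" by (intro finite_cartesian_product finite_PiE) auto
    show "measure_pmf.prob (edge_pmf n p) (?X x) \<le> ?b" if "x \<in> ?I" for x
    proof (cases x)
      case (Pair S B)
      with that have "measure_pmf.prob (edge_pmf n p)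
          {f. common_nbrs (graph_of n f) {..<m} S \<subseteq> B} \<le> ?b"
        by (intro prob_common_nbrs_subset_le p) auto
      thus ?thesis by (simp add: Pair)
    qed
  qed
  also have "\<dots> \<le> real (n ^ ((m + 1) * s)) * ?b"
  proof (intro mult_right_mono of_nat_mono)
    have "card ?I = card (subsets_of_card n s) ^ (m + 1)"
      by (simp add: card_cartesian_product card_PiE)
    also have "\<dots> \<le> (n ^ s) ^ (m + 1)"
      using card_subsets_of_card_le[OF s] by (rule power_mono) simp
    finally show "card ?I \<le> n ^ ((m + 1) * s)"
      by (simp add: power_mult mult.commute flip: power_mult power_add)
    show "0 \<le> ?b" using p by (auto simp: power_le_one)
  qed
  finally show ?thesis by simp
qed

section \<open>Large \<open>s\<close>: union bound over two sets without edges between them\<close>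

lemma card_doubletons_between_ge:
  assumes "finite S" "finite T"
  shows "card T * (card S - 1) \<le> 2 * card ((\<lambda>(v, u). {u, v}) ` (SIGMA v:T. S - {v}))"
proof -
  let ?Z = "SIGMA v:T. S - {v}" and ?h = "\<lambda>(v, u). {u, v}"
  have "card T * (card S - 1) = (\<Sum>v\<in>T. card S - 1)" by simp
  \<comment> \<open>The sets may overlap, so \<open>v\<close> itself may have to be left out of
    \<open>S\<close>.\<close>
  also have "\<dots> \<le> (\<Sum>v\<in>T. card (S - {v}))"
    using assms by (intro sum_mono) (simp add: card_Diff_singleton_if)
  also have "\<dots> = card ?Z" using assms by simp
  also have "?Z = (\<Union>e\<in>?h ` ?Z. {z \<in> ?Z. ?h z = e})" by blast
  also have "card \<dots> \<le> (\<Sum>e\<in>?h ` ?Z. card {z \<in> ?Z. ?h z = e})"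
    using assms by (intro card_UN_le) auto
  \<comment> \<open>An edge with both ends in the overlap is counted twice, once from each
    end.\<close>
  also have "\<dots> \<le> (\<Sum>e\<in>?h ` ?Z. 2)"
  proof (rule sum_mono)
    fix e assume "e \<in> ?h ` ?Z"
    then obtain a b where "e = {a, b}" by auto
    hence "{z \<in> ?Z. ?h z = e} \<subseteq> {(a, b), (b, a)}" by (auto simp: doubleton_eq_iff)
    hence "card {z \<in> ?Z. ?h z = e} \<le> card {(a, b), (b, a)}" by (intro card_mono) auto
    thus "card {z \<in> ?Z. ?h z = e} \<le> 2" by (auto simp: card_insert_if split: if_splits)
  qed
  finally show ?thesis by simp
qed

lemma power_one_minus_le_exp:
  fixes x :: real
  assumes "x \<le> 1"
  shows "(1 - x) ^ k \<le> exp (- (x * real k))"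
proof -
  have "(1 - x) ^ k \<le> exp (- x) ^ k"
    using assms exp_ge_add_one_self[of "- x"] by (intro power_mono) auto
  thus ?thesis by (simp add: exp_of_nat_mult[symmetric] mult.commute)
qed

lemma prob_no_edges_between_le:
  assumes p: "0 \<le> p" "p \<le> 1" and S: "S \<in> subsets_of_card n s" and T: "T \<in> subsets_of_card n t"
  shows "measure_pmf.prob (edge_pmf n p) {f. \<forall>v\<in>T. \<forall>u\<in>S. {u, v} \<notin> edges (graph_of n f)}
    \<le> exp (- (p * (real t * real (s - 1) / 2)))"
proof -
  let ?Z = "SIGMA v:T. S - {v}" and ?h = "\<lambda>(v, u). {u, v}"
  have fin: "finite S" "finite T" "card S = s" "card T = t"
    using S T by (auto simp: subsets_of_card_def intro: finite_subset)
  have D: "?h ` ?Z \<subseteq> vertex_pairs n"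
    using S T by (fastforce simp: subsets_of_card_def doubleton_in_vertex_pairs)
  have "measure_pmf.prob (edge_pmf n p) {f. \<forall>v\<in>T. \<forall>u\<in>S. {u, v} \<notin> edges (graph_of n f)}
      \<le> measure_pmf.prob (edge_pmf n p) {f. \<forall>e\<in>?h ` ?Z. \<not> f e}"
    using D by (intro measure_pmf.finite_measure_mono) auto
  also have "\<dots> = (1 - p) ^ card (?h ` ?Z)"
    unfolding edge_pmf_def using D p by (intro prob_bernoulli_all_False) auto
  also have "\<dots> \<le> exp (- (p * real (card (?h ` ?Z))))"
    using p by (intro power_one_minus_le_exp)
  also have "\<dots> \<le> exp (- (p * (real t * real (s - 1) / 2)))"
  proof -
    have "real (t * (s - 1)) \<le> real (2 * card (?h ` ?Z))"
      using card_doubletons_between_ge[OF fin(1,2)] fin by (intro of_nat_mono) simp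
    hence "real t * real (s - 1) / 2 \<le> real (card (?h ` ?Z))" by simp
    thus ?thesis using p by (intro exp_mono le_imp_neg_le mult_left_mono)
  qed
  finally show ?thesis .
qed

text \<open>If expansion fails, at least \<open>n - s\<close> vertices each miss some
  \<open>S i\<close>. By pigeonhole a single \<open>S i\<close> is missed by \<open>t\<close> of
  them, which gives the set \<open>T\<close>.\<close>

lemma prob_not_expands_le_many:
  assumes p: "0 \<le> p" "p \<le> 1" and s: "s \<le> n" and t: "m * (t - 1) < n - s" "t \<le> n"
  shows "measure_pmf.prob (edge_pmf n p) {f. \<not> expands (graph_of n f) m s}
    \<le> real n ^ (n - s + t) * exp (- (p * (real t * real (s - 1) / 2)))"
proof -
  let ?I = "subsets_of_card n s \<times> subsets_of_card n t"
  let ?X = "\<lambda>(S, T). {f. \<forall>v\<in>T. \<forall>u\<in>S. {u, v} \<notin> edges (graph_of n f)}"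
  let ?b = "exp (- (p * (real t * real (s - 1) / 2)))"
  have "{f. \<not> expands (graph_of n f) m s} \<subseteq> (\<Union>x\<in>?I. ?X x)"
  proof
    fix f assume "f \<in> {f. \<not> expands (graph_of n f) m s}"
    then obtain S where S: "\<forall>i<m. S i \<subseteq> {1..n} \<and> card (S i) = s"
        "card (common_nbrs (graph_of n f) {..<m} S) \<le> s"
      by (auto simp: expands_def not_less)
    define Z where "Z i = {v \<in> {1..n}. \<forall>u\<in>S i. {u, v} \<notin> edges (graph_of n f)}" for i
    have "\<exists>i<m. t \<le> card (Z i)"
    proof (rule ccontr)
      assume "\<not> (\<exists>i<m. t \<le> card (Z i))"
      hence small: "card (Z i) \<le> t - 1" if "i < m" for i using that by force
      have "n - s \<le> card ({1..n} - common_nbrs (graph_of n f) {..<m} S)"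
        using S(2) diff_card_le_card_Diff[of "common_nbrs (graph_of n f) {..<m} S" "{1..n}"]
          finite_subset[OF common_nbrs_subset, of "graph_of n f" "{..<m}" S] by simp
      also have "{1..n} - common_nbrs (graph_of n f) {..<m} S = (\<Union>i<m. Z i)"
        by (auto simp: common_nbrs_def Z_def)
      also have "card \<dots> \<le> (\<Sum>i<m. card (Z i))" by (rule card_UN_le) simp
      also have "\<dots> \<le> (\<Sum>i<m. t - 1)" using small by (intro sum_mono) simp
      finally show False using t by simp
    qed
    then obtain i T where "i < m" "T \<subseteq> Z i" "card T = t"
      using obtain_subset_with_card_n by metis
    hence "(S i, T) \<in> ?I \<and> f \<in> ?X (S i, T)"
      using S by (auto simp: subsets_of_card_def Z_def)
    thus "f \<in> (\<Union>x\<in>?I. ?X x)" by blast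
  qed
  hence "measure_pmf.prob (edge_pmf n p) {f. \<not> expands (graph_of n f) m s} \<le>
      measure_pmf.prob (edge_pmf n p) (\<Union>x\<in>?I. ?X x)"
    by (rule measure_pmf.finite_measure_mono) simp
  also have "\<dots> \<le> real (card ?I) * ?b"
  proof (rule prob_UN_le)
    show "measure_pmf.prob (edge_pmf n p) (?X x) \<le> ?b" if "x \<in> ?I" for x
      using that prob_no_edges_between_le[OF p] by (cases x) auto
  qed simp
  also have "\<dots> \<le> real (n ^ (n - s + t)) * ?b"
  proof (intro mult_right_mono of_nat_mono)
    \<comment> \<open>Counting \<open>S\<close> through its complement keeps the exponent of order
      \<open>n - s\<close>, hence of order \<open>t\<close>, even when \<open>s\<close> is close to
      \<open>n\<close>.\<close>
    have "card ?I = (n choose (n - s)) * (n choose t)"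
      using binomial_symmetric[OF s] by (simp add: card_cartesian_product card_subsets_of_card)
    also have "\<dots> \<le> n ^ (n - s) * n ^ t"
      using t by (intro mult_mono binomial_le_pow) auto
    finally show "card ?I \<le> n ^ (n - s + t)" by (simp add: power_add)
  qed simp
  finally show ?thesis by simp
qed

text \<open>For \<open>p * s > L\<close> a union bound over all families \<open>S\<close> in \<open>expands\<close> would fail. One pair
  \<open>S i\<close>, \<open>T\<close> without edges, where \<open>T\<close> has about \<open>(n - s) / m\<close> elements, is then unlikely enough.\<close>

lemma prob_not_expands_le:
  fixes n m :: nat
  defines "L \<equiv> 4 * real (m + 3) * ln (real n)"
  assumes p: "0 \<le> p" "p \<le> 1" and m: "1 \<le> m" and n: "3 \<le> n" and s: "1 \<le> s" "s < n"
    and dense: "2 * real (m + 3) * ln (real n) * (1 + L) ^ m \<le> real n * p ^ m"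
  shows "measure_pmf.prob (edge_pmf n p) {f. \<not> expands (graph_of n f) m s} \<le> 1 / (real n)\<^sup>2"
proof -
  define l where "l = ln (real n)"
  have "exp 1 \<le> real n" using exp_le n by linarith
  hence l: "1 \<le> l" using n by (simp add: l_def ln_ge_iff)
  have L: "L = 4 * real (m + 3) * l" by (simp add: L_def l_def)
  have "1 * 1 \<le> real (m + 3) * l" using l by (intro mult_mono) auto
  hence L4: "4 \<le> L" by (simp add: L algebra_simps)
  have npow: "real n ^ k = exp (real k * l)" for k
    using n by (simp add: l_def exp_of_nat_mult)
  \<comment> \<open>In both cases the union bound costs a factor \<open>n ^ ((m + 1) * j)\<close>
    and the probability gains \<open>n ^ ((m + 3) * j)\<close>, with \<open>j\<close> being
    \<open>s\<close> or \<open>t\<close>; this surplus of two dictates the constant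
    \<open>m + 3\<close>.\<close>
  have final: "exp (- (2 * real j * l)) \<le> 1 / (real n)\<^sup>2" if "1 \<le> j" for j :: nat
  proof -
    have "2 * 1 * l \<le> 2 * real j * l" using that l by (intro mult_right_mono) auto
    hence "exp (- (2 * real j * l)) \<le> exp (- (2 * l))" by simp
    also have "\<dots> = 1 / (real n)\<^sup>2" using npow[of 2] by (simp add: exp_minus field_simps)
    finally show ?thesis .
  qed
  show ?thesis
  proof (cases "p * real s \<le> L")
    case True
    define q where "q = 1 - (1 - p) ^ s"
    have "0 < 2 * real (m + 3) * l * (1 + L) ^ m"
      using l L4 by (intro mult_pos_pos zero_less_power) auto
    hence "p \<noteq> 0" using dense m by (auto simp: l_def power_0_left)
    hence p0: "0 < p" using p by simp
    \<comment> \<open>With \<open>x = p * s\<close>, the bound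
      \<open>exp (- x) \<le> 1 / (1 + x)\<close> gives \<open>q \<ge> x / (1 + x)\<close>, and
      \<open>x \<le> L\<close> makes this at least \<open>x / (1 + L)\<close>.\<close>
    have "(1 - p) ^ s \<le> exp (- (p * real s))"
      using p by (intro power_one_minus_le_exp)
    also have "\<dots> \<le> 1 / (1 + p * real s)"
      using p exp_ge_add_one_self[of "p * real s"]
      by (simp add: exp_minus divide_inverse le_imp_inverse_le add_pos_nonneg)
    finally have "1 - 1 / (1 + p * real s) \<le> q" by (simp add: q_def)
    moreover have "1 - 1 / (1 + p * real s) = p * real s / (1 + p * real s)"
      using p by (simp add: field_simps add_nonneg_eq_0_iff)
    moreover have "p * real s / (1 + L) \<le> p * real s / (1 + p * real s)"
      using True p L4 by (intro divide_left_mono mult_pos_pos) (auto intro!: add_pos_nonneg)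
    ultimately have q: "p * real s / (1 + L) \<le> q" by linarith
    have q1: "q ^ m \<le> 1" "0 \<le> q ^ m"
      using p by (auto simp: q_def power_le_one)

    \<comment> \<open>Density also shows that the tested vertices make up at least half of the
      graph; one factor \<open>p\<close> is cancelled at the end.\<close>
    have "2 * real (m + 1) * (p * real s) \<le> (2 * real (m + 3) * l) * (1 + L)"
    proof (rule mult_mono)
      have "2 * real (m + 1) * 1 \<le> 2 * real (m + 3) * l" using l by (intro mult_mono) auto
      thus "2 * real (m + 1) \<le> 2 * real (m + 3) * l" by simp
    qed (use True p l in auto)
    also have "\<dots> \<le> (2 * real (m + 3) * l) * (1 + L) ^ m"
      using L4 l m by (intro mult_left_mono self_le_power) auto
    also have "\<dots> \<le> real n * p ^ m" using dense by (simp add: l_def)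
    also have "\<dots> \<le> real n * p ^ 1"
      using p m by (intro mult_left_mono power_decreasing) auto
    finally have "(2 * real (m + 1) * real s) * p \<le> real n * p" by (simp add: mult_ac)
    hence "2 * real (m + 1) * real s \<le> real n" using p0 by simp
    hence "real (2 * ((m + 1) * s)) \<le> real n" by (simp add: algebra_simps)
    hence half': "2 * ((m + 1) * s) \<le> n" by (simp only: of_nat_le_iff)
    hence half: "real n / 2 \<le> real (n - (m + 1) * s)" by linarith

    \<comment> \<open>As \<open>m \<ge> 1\<close>, \<open>s\<close> may be replaced by
      \<open>s ^ m\<close>, which density then combines into
      \<open>(p * s / (1 + L)) ^ m\<close>.\<close>
    have "real (m + 3) * real s * l \<le> real (m + 3) * real s ^ m * l"
      using l s m by (intro mult_right_mono mult_left_mono self_le_power) auto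
    also have "\<dots> = (2 * real (m + 3) * l * (1 + L) ^ m) * (real s ^ m / (2 * (1 + L) ^ m))"
      using L4 by (simp add: field_simps)
    also have "\<dots> \<le> (real n * p ^ m) * (real s ^ m / (2 * (1 + L) ^ m))"
      using dense L4 by (intro mult_right_mono) (auto simp: l_def)
    also have "\<dots> = (p * real s / (1 + L)) ^ m * (real n / 2)"
      by (simp add: power_mult_distrib power_divide mult_ac)
    also have "\<dots> \<le> q ^ m * real (n - (m + 1) * s)"
      using q half p L4 q1 by (intro mult_mono power_mono) auto
    finally have expo: "real (m + 3) * real s * l \<le> q ^ m * real (n - (m + 1) * s)" .

    have "measure_pmf.prob (edge_pmf n p) {f. \<not> expands (graph_of n f) m s}
        \<le> real n ^ ((m + 1) * s) * (1 - q ^ m) ^ (n - (m + 1) * s)"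
      unfolding q_def using p s by (intro prob_not_expands_le_few) auto
    also have "\<dots> \<le> exp (real ((m + 1) * s) * l) * exp (- (q ^ m * real (n - (m + 1) * s)))"
      unfolding npow using q1 by (intro mult_left_mono power_one_minus_le_exp) auto
    also have "\<dots> \<le> exp (real ((m + 1) * s) * l) * exp (- (real (m + 3) * real s * l))"
      using expo by simp
    also have "\<dots> = exp (- (2 * real s * l))"
      by (simp add: algebra_simps flip: exp_add)
    also have "\<dots> \<le> 1 / (real n)\<^sup>2" using s by (intro final)
    finally show ?thesis .
  next
    case False
    \<comment> \<open>This is \<open>(n - s) / m\<close> rounded up: the pigeonhole needs
      \<open>m * (t - 1) < n - s\<close>, the final count needs
      \<open>n - s \<le> m * t\<close>.\<close>
    define t where "t = (n - s - 1) div m + 1"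
    have t1: "1 \<le> t" by (simp add: t_def)
    have "m * (t - 1) \<le> n - s - 1" by (simp add: t_def)
    hence tm: "m * (t - 1) < n - s" using s by linarith
    have "n - s - 1 < m * t"
      using m dividend_less_times_div[of m "n - s - 1"] by (simp add: t_def algebra_simps)
    hence "n - s + t \<le> (m + 1) * t" by simp
    moreover have "(n - s - 1) div m \<le> n - s - 1" by simp
    hence tn: "t \<le> n" using s unfolding t_def by linarith
    have "p * real s \<le> 1 * real s" using p by (intro mult_right_mono) auto
    \<comment> \<open>This allows \<open>s - 1\<close> to be bounded below by \<open>s / 2\<close>;
      the 4 in \<open>L\<close> pays for this loss and for the double counting of edges.\<close>
    hence "4 \<le> s" using False L4 by linarith
    have "real t * (real (m + 3) * l) \<le> real t * (p * real s / 4)"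
      using False by (intro mult_left_mono) (auto simp: L algebra_simps)
    moreover have "real t * (p * real s / 4) = p * (real t * (real s / 2) / 2)" by simp
    moreover have "p * (real t * (real s / 2) / 2) \<le> p * (real t * real (s - 1) / 2)"
      using p \<open>4 \<le> s\<close> by (intro mult_left_mono divide_right_mono) auto
    ultimately have expo: "real t * (real (m + 3) * l) \<le> p * (real t * real (s - 1) / 2)"
      by linarith

    have "measure_pmf.prob (edge_pmf n p) {f. \<not> expands (graph_of n f) m s}
        \<le> real n ^ (n - s + t) * exp (- (p * (real t * real (s - 1) / 2)))"
      using p s tm tn by (intro prob_not_expands_le_many) auto
    also have "\<dots> \<le> real n ^ ((m + 1) * t) * exp (- (real t * (real (m + 3) * l)))"
      using expo n \<open>n - s + t \<le> (m + 1) * t\<close> by (intro mult_mono power_increasing) auto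
    also have "\<dots> = exp (- (2 * real t * l))"
      unfolding npow by (simp add: algebra_simps flip: exp_add)
    also have "\<dots> \<le> 1 / (real n)\<^sup>2" using t1 by (intro final)
    finally show ?thesis .
  qed
qed

section \<open>Summing over \<open>s\<close> and letting \<open>n\<close> grow\<close>

lemma prob_gnp_warm_ge:
  fixes n m :: nat
  assumes p: "0 \<le> p" "p \<le> 1" and m: "1 \<le> m" and n: "3 \<le> n"
    and dense: "2 * real (m + 3) * ln (real n) * (1 + 4 * real (m + 3) * ln (real n)) ^ m
      \<le> real n * p ^ m"
  shows "1 - 1 / real n \<le> measure_pmf.prob (gnp n p) {G. is_warm (m + 2) G}"
proof -
  let ?P = "measure_pmf.prob (edge_pmf n p)"
  let ?W = "{f. is_warm (m + 2) (graph_of n f)}"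
  have "- ?W \<subseteq> (\<Union>s\<in>{1..<n}. {f. \<not> expands (graph_of n f) m s})"
    using is_warm_if_expands[of "graph_of n _" m] n by fastforce
  hence "?P (- ?W) \<le> ?P (\<Union>s\<in>{1..<n}. {f. \<not> expands (graph_of n f) m s})"
    by (rule measure_pmf.finite_measure_mono) simp
  also have "\<dots> \<le> real (card {1..<n}) * (1 / (real n)\<^sup>2)"
    by (intro prob_UN_le prob_not_expands_le) (use assms in auto)
  also have "\<dots> \<le> real n * (1 / (real n)\<^sup>2)"
    by (intro mult_right_mono) auto
  also have "\<dots> = 1 / real n"
    by (simp add: power2_eq_square)
  finally have "1 - 1 / real n \<le> ?P ?W"
    using measure_pmf.prob_compl[of ?W "edge_pmf n p"] by (simp add: Compl_eq_Diff_UNIV)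
  thus ?thesis by (simp add: gnp_eq vimage_def)
qed

text \<open>The right side is at least \<open>c ^ m\<close> times \<open>n\<close> to the positive
  power \<open>1 - \<alpha> * m\<close>, while the left side is polylogarithmic.\<close>

lemma eventually_dense:
  fixes \<alpha> :: real and p :: "nat \<Rightarrow> real" and m :: nat
  assumes "\<And>n. 0 \<le> p n" and omega: "p \<in> \<Omega>(\<lambda>n. real n powr (- \<alpha>))" and m: "\<alpha> * real m < 1"
  shows "eventually (\<lambda>n. 2 * real (m + 3) * ln (real n) * (1 + 4 * real (m + 3) * ln (real n)) ^ m
      \<le> real n * p n ^ m) sequentially"
proof -
  obtain c where c: "c > 0" "eventually (\<lambda>n. c * norm (real n powr (- \<alpha>)) \<le> norm (p n)) sequentially"
    using landau_omega.bigE[OF omega] .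
  define e where "e = 1 - \<alpha> * real m"
  have e: "0 < e" using m by (simp add: e_def)
  \<comment> \<open>For \<open>n \<ge> 3\<close> the logarithm is at least 1, so the summand 1 is
    absorbed and \<open>4 * (m + 3) + 1 = 4 * m + 13\<close> appears.\<close>
  define K where "K = 2 * real (m + 3) * real (4 * m + 13) ^ m"
  have K: "0 < K" unfolding K_def by (intro mult_pos_pos zero_less_power) auto
  have "(\<lambda>n. ln (real n) ^ (m + 1)) \<in> o(\<lambda>n. real n powr e)"
    using e by real_asymp
  hence "eventually (\<lambda>n. norm (ln (real n) ^ (m + 1)) \<le> (c ^ m / K) * norm (real n powr e)) sequentially"
    using c(1) K by (intro landau_o.smallD) auto
  thus ?thesis
    using c(2) eventually_ge_at_top[of 3]
  proof eventually_elim
    case (elim n)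
    have "exp 1 \<le> real n" using exp_le elim(3) by linarith
    hence ln: "1 \<le> ln (real n)" using elim(3) by (simp add: ln_ge_iff)
    have "1 + 4 * real (m + 3) * ln (real n) \<le> real (4 * m + 13) * ln (real n)"
      using ln by (simp add: algebra_simps)
    hence "2 * real (m + 3) * ln (real n) * (1 + 4 * real (m + 3) * ln (real n)) ^ m
        \<le> 2 * real (m + 3) * ln (real n) * (real (4 * m + 13) * ln (real n)) ^ m"
      using ln by (intro mult_left_mono power_mono) auto
    also have "\<dots> = K * ln (real n) ^ (m + 1)"
      unfolding K_def power_mult_distrib by simp
    also have "\<dots> \<le> K * ((c ^ m / K) * real n powr e)"
      using elim(1) ln K by (intro mult_left_mono) auto
    also have "\<dots> = real n * (c * real n powr (- \<alpha>)) ^ m"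
    proof -
      have "(real n powr (- \<alpha>)) ^ m = real n powr (- (\<alpha> * real m))"
        using elim(3) by (simp add: powr_powr flip: powr_realpow)
      thus ?thesis
        using elim(3) K by (simp add: e_def power_mult_distrib powr_diff powr_minus divide_inverse)
    qed
    also have "\<dots> \<le> real n * p n ^ m"
      using elim(2) c(1) assms(1)[of n] by (intro mult_left_mono power_mono) auto
    finally show ?case .
  qed
qed

theorem theorem3p3:
  fixes \<alpha> :: real and p :: "nat \<Rightarrow> real"
  assumes "\<alpha> > 0"
    and "\<And>n. 0 \<le> p n \<and> p n \<le> 1"
    and "p \<in> \<Omega>(\<lambda>n. real n powr (- \<alpha>))"
  shows "(\<lambda>n. measure_pmf.prob (gnp n (p n))
            {G. warmth G \<ge> enat (nat \<lceil>1 / \<alpha> + 1\<rceil>)}) \<longlonglongrightarrow> 1"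
proof -
  \<comment> \<open>The largest integer strictly below \<open>1 / \<alpha>\<close>; strictness makes
    the exponent \<open>1 - \<alpha> * m\<close> positive.\<close>
  define m where "m = nat (\<lceil>1 / \<alpha>\<rceil> - 1)"
  let ?P = "\<lambda>n. measure_pmf.prob (gnp n (p n))"
  have "0 < \<lceil>1 / \<alpha>\<rceil>" using assms(1) by simp
  moreover have "\<lceil>1 / \<alpha> + 1\<rceil> = \<lceil>1 / \<alpha>\<rceil> + 1" by simp
  ultimately have d: "nat \<lceil>1 / \<alpha> + 1\<rceil> = m + 2"
      and m_eq: "real m = real_of_int \<lceil>1 / \<alpha>\<rceil> - 1"
    unfolding m_def by linarith+
  have "real m < 1 / \<alpha>" unfolding m_eq by linarith
  hence m: "\<alpha> * real m < 1" using assms(1) by (simp add: field_simps)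
  have "eventually (\<lambda>n. 1 - 1 / real n \<le> ?P n {G. is_warm (m + 2) G}) sequentially"
  \<comment> \<open>The random-graph bounds need \<open>m \<ge> 1\<close>; for \<open>m = 0\<close>
    every graph is already \<open>2\<close>-warm.\<close>
  proof (cases "m = 0")
    case True
    hence "is_warm (m + 2) G" for G :: "nat ugraph"
      using is_warm_2[of G] by (metis add_0)
    thus ?thesis by simp
  next
    case False
    have "eventually (\<lambda>n. 2 * real (m + 3) * ln (real n) * (1 + 4 * real (m + 3) * ln (real n)) ^ m
        \<le> real n * p n ^ m) sequentially"
      using assms m by (intro eventually_dense) auto
    thus ?thesis
      using eventually_ge_at_top[of 3]
    proof eventually_elim
      case (elim n)
      then show ?case using False assms(2)[of n] by (intro prob_gnp_warm_ge) auto
    qed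
  qed
  hence lower: "eventually (\<lambda>n. 1 - 1 / real n \<le> ?P n {G. warmth G \<ge> enat (m + 2)}) sequentially"
  proof eventually_elim
    case (elim n)
    also have "?P n {G. is_warm (m + 2) G} \<le> ?P n {G. warmth G \<ge> enat (m + 2)}"
      by (intro measure_pmf.finite_measure_mono) (auto intro: warmth_ge)
    finally show ?case .
  qed
  have "(\<lambda>n. ?P n {G. warmth G \<ge> enat (m + 2)}) \<longlonglongrightarrow> 1"
  proof (rule tendsto_sandwich[OF lower])
    show "(\<lambda>n. 1 - 1 / real n) \<longlonglongrightarrow> 1" by real_asymp
  qed auto
  thus ?thesis unfolding d .
qed

end
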